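(* Let $R$ be a relation on a type $X$ such that: (i) $X$ has decidable equality; (ii) $R$ is single-valued, i.e. for all $x,y,z:X$, $xRy$ and $xRz$ imply $y=z$; (iii) $\sum_{y:X}xRy$ is decidable for every $x:X$. Then for every natural number $k$, the $k$-step reflexive transitive closure $R^k$ is decidable, i.e. $xR^ky$ is decidable for all $x,y:X$.
   Context: The ambient theory is intensional Martin-Löf type theory with function extensionality and propositional truncation $\|-\|$. A relation on $X$ is $R:X\to X\to\Omega$, where $\Omega$ is the type of propositions. A type $Y$ is decidable if $Y+\neg Y$ holds. $X$ has decidable equality if $x=y$ is decidable for all $x,y:X$. The $k$-step closure is defined by $xR_0y:=(x=y)$, $xR_{k+1}z:=\sum_{y:X}xRy\times yR_kz$, and $xR^ky:=\|xR_ky\|$. *)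

theory Defs
  imports Main
begin

text \<open>
  Decidability of \<open>Y\<close> means inhabitation of \<open>Y + \<not> Y\<close> in intensional Martin-Loef type theory.
  Read as a formula of HOL it would hold for every \<open>Y\<close> by excluded middle, so the type theory is
  deeply embedded: a theorem of the type theory is a closed type that has a derivable closed term.

  The presentation follows the formal type theory of the appendix (Section A.2) of the HoTT book,
  with cumulative Russell universes and typed judgemental equality.  Univalence is left out;
  function extensionality and propositional truncation are constants with their own rules.  The
  congruence rules, which the book leaves implicit, are spelled out.
\<close>

text \<open>
  Variables are de Bruijn indices.  \<open>Pi A B\<close>, \<open>Sig A B\<close> and \<open>Lam A b\<close> bind one variable in their
  second argument.  The first argument of every eliminator is the motive; it binds one variable,
  except in \<open>IndEq\<close>, where it binds \<open>x, y, p\<close> with \<open>p\<close> innermost (index 0), and in the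
  non-dependent \<open>TrRec\<close>, where it binds none.  Among the branches,
  \<open>IndSig C g p\<close> binds two variables in \<open>g\<close>,
  \<open>IndSum C c d e\<close> binds one in \<open>c\<close> and one in \<open>d\<close>,
  \<open>IndNat C c s n\<close> binds two in \<open>s\<close> (the predecessor, then, innermost, the recursive value), and
  \<open>IndEq C c a b p\<close> binds one in \<open>c\<close>.
\<close>

datatype tm =
    Var nat
  | Univ nat
  | Pi tm tm | Lam tm tm | App tm tm
  | Sig tm tm | Pair tm tm | IndSig tm tm tm
  | Sum tm tm | Inl tm | Inr tm | IndSum tm tm tm tm
  | Empty | IndEmpty tm tm
  | One | Star | IndOne tm tm tm
  | NatT | Zero | Succ tm | IndNat tm tm tm tm
  | Eq tm tm tm | Refl tm | IndEq tm tm tm tm tm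
  | Trunc tm | TrIn tm | TrEq tm tm | TrRec tm tm tm tm
  | Funext tm tm tm

abbreviation scons :: "'a \<Rightarrow> (nat \<Rightarrow> 'a) \<Rightarrow> nat \<Rightarrow> 'a"  (infixr "\<cdot>" 70) where
  "a \<cdot> \<sigma> \<equiv> case_nat a \<sigma>"

definition up_ren :: "(nat \<Rightarrow> nat) \<Rightarrow> nat \<Rightarrow> nat" where
  "up_ren \<rho> = 0 \<cdot> (\<lambda>n. Suc (\<rho> n))"

primrec ren :: "(nat \<Rightarrow> nat) \<Rightarrow> tm \<Rightarrow> tm" where
  "ren \<rho> (Var n) = Var (\<rho> n)"
| "ren \<rho> (Univ i) = Univ i"
| "ren \<rho> (Pi A B) = Pi (ren \<rho> A) (ren (up_ren \<rho>) B)"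
| "ren \<rho> (Lam A b) = Lam (ren \<rho> A) (ren (up_ren \<rho>) b)"
| "ren \<rho> (App f a) = App (ren \<rho> f) (ren \<rho> a)"
| "ren \<rho> (Sig A B) = Sig (ren \<rho> A) (ren (up_ren \<rho>) B)"
| "ren \<rho> (Pair a b) = Pair (ren \<rho> a) (ren \<rho> b)"
| "ren \<rho> (IndSig C g p) = IndSig (ren (up_ren \<rho>) C) (ren (up_ren (up_ren \<rho>)) g) (ren \<rho> p)"
| "ren \<rho> (Sum A B) = Sum (ren \<rho> A) (ren \<rho> B)"
| "ren \<rho> (Inl a) = Inl (ren \<rho> a)"
| "ren \<rho> (Inr b) = Inr (ren \<rho> b)"
| "ren \<rho> (IndSum C c d e) =
     IndSum (ren (up_ren \<rho>) C) (ren (up_ren \<rho>) c) (ren (up_ren \<rho>) d) (ren \<rho> e)"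
| "ren \<rho> Empty = Empty"
| "ren \<rho> (IndEmpty C e) = IndEmpty (ren (up_ren \<rho>) C) (ren \<rho> e)"
| "ren \<rho> One = One"
| "ren \<rho> Star = Star"
| "ren \<rho> (IndOne C c e) = IndOne (ren (up_ren \<rho>) C) (ren \<rho> c) (ren \<rho> e)"
| "ren \<rho> NatT = NatT"
| "ren \<rho> Zero = Zero"
| "ren \<rho> (Succ n) = Succ (ren \<rho> n)"
| "ren \<rho> (IndNat C c s n) =
     IndNat (ren (up_ren \<rho>) C) (ren \<rho> c) (ren (up_ren (up_ren \<rho>)) s) (ren \<rho> n)"
| "ren \<rho> (Eq A a b) = Eq (ren \<rho> A) (ren \<rho> a) (ren \<rho> b)"
| "ren \<rho> (Refl a) = Refl (ren \<rho> a)"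
| "ren \<rho> (IndEq C c a b p) =
     IndEq (ren (up_ren (up_ren (up_ren \<rho>))) C) (ren (up_ren \<rho>) c) (ren \<rho> a) (ren \<rho> b) (ren \<rho> p)"
| "ren \<rho> (Trunc A) = Trunc (ren \<rho> A)"
| "ren \<rho> (TrIn a) = TrIn (ren \<rho> a)"
| "ren \<rho> (TrEq a b) = TrEq (ren \<rho> a) (ren \<rho> b)"
| "ren \<rho> (TrRec B h f e) = TrRec (ren \<rho> B) (ren \<rho> h) (ren \<rho> f) (ren \<rho> e)"
| "ren \<rho> (Funext f g h) = Funext (ren \<rho> f) (ren \<rho> g) (ren \<rho> h)"

abbreviation wk :: "nat \<Rightarrow> tm \<Rightarrow> tm" where
  "wk k \<equiv> ren (\<lambda>n. n + k)"

definition up :: "(nat \<Rightarrow> tm) \<Rightarrow> nat \<Rightarrow> tm" where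
  "up \<sigma> = Var 0 \<cdot> (\<lambda>n. wk 1 (\<sigma> n))"

primrec subst :: "(nat \<Rightarrow> tm) \<Rightarrow> tm \<Rightarrow> tm" where
  "subst \<sigma> (Var n) = \<sigma> n"
| "subst \<sigma> (Univ i) = Univ i"
| "subst \<sigma> (Pi A B) = Pi (subst \<sigma> A) (subst (up \<sigma>) B)"
| "subst \<sigma> (Lam A b) = Lam (subst \<sigma> A) (subst (up \<sigma>) b)"
| "subst \<sigma> (App f a) = App (subst \<sigma> f) (subst \<sigma> a)"
| "subst \<sigma> (Sig A B) = Sig (subst \<sigma> A) (subst (up \<sigma>) B)"
| "subst \<sigma> (Pair a b) = Pair (subst \<sigma> a) (subst \<sigma> b)"
| "subst \<sigma> (IndSig C g p) = IndSig (subst (up \<sigma>) C) (subst (up (up \<sigma>)) g) (subst \<sigma> p)"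
| "subst \<sigma> (Sum A B) = Sum (subst \<sigma> A) (subst \<sigma> B)"
| "subst \<sigma> (Inl a) = Inl (subst \<sigma> a)"
| "subst \<sigma> (Inr b) = Inr (subst \<sigma> b)"
| "subst \<sigma> (IndSum C c d e) =
     IndSum (subst (up \<sigma>) C) (subst (up \<sigma>) c) (subst (up \<sigma>) d) (subst \<sigma> e)"
| "subst \<sigma> Empty = Empty"
| "subst \<sigma> (IndEmpty C e) = IndEmpty (subst (up \<sigma>) C) (subst \<sigma> e)"
| "subst \<sigma> One = One"
| "subst \<sigma> Star = Star"
| "subst \<sigma> (IndOne C c e) = IndOne (subst (up \<sigma>) C) (subst \<sigma> c) (subst \<sigma> e)"
| "subst \<sigma> NatT = NatT"
| "subst \<sigma> Zero = Zero"
| "subst \<sigma> (Succ n) = Succ (subst \<sigma> n)"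
| "subst \<sigma> (IndNat C c s n) =
     IndNat (subst (up \<sigma>) C) (subst \<sigma> c) (subst (up (up \<sigma>)) s) (subst \<sigma> n)"
| "subst \<sigma> (Eq A a b) = Eq (subst \<sigma> A) (subst \<sigma> a) (subst \<sigma> b)"
| "subst \<sigma> (Refl a) = Refl (subst \<sigma> a)"
| "subst \<sigma> (IndEq C c a b p) =
     IndEq (subst (up (up (up \<sigma>))) C) (subst (up \<sigma>) c) (subst \<sigma> a) (subst \<sigma> b) (subst \<sigma> p)"
| "subst \<sigma> (Trunc A) = Trunc (subst \<sigma> A)"
| "subst \<sigma> (TrIn a) = TrIn (subst \<sigma> a)"
| "subst \<sigma> (TrEq a b) = TrEq (subst \<sigma> a) (subst \<sigma> b)"
| "subst \<sigma> (TrRec B h f e) = TrRec (subst \<sigma> B) (subst \<sigma> h) (subst \<sigma> f) (subst \<sigma> e)"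
| "subst \<sigma> (Funext f g h) = Funext (subst \<sigma> f) (subst \<sigma> g) (subst \<sigma> h)"

definition Arr :: "tm \<Rightarrow> tm \<Rightarrow> tm" where
  "Arr A B = Pi A (wk 1 B)"

definition Times :: "tm \<Rightarrow> tm \<Rightarrow> tm" where
  "Times A B = Sig A (wk 1 B)"

definition Neg :: "tm \<Rightarrow> tm" where
  "Neg A = Arr A Empty"

definition Dec :: "tm \<Rightarrow> tm" where
  "Dec A = Sum A (Neg A)"

definition is_prop :: "tm \<Rightarrow> tm" where
  "is_prop A = Pi A (Pi (wk 1 A) (Eq (wk 2 A) (Var 1) (Var 0)))"

text \<open>The type of propositions of the \<open>j\<close>-th universe, \<open>\<Sigma> (P : U\<^sub>j). is_prop P\<close>.\<close>

definition Omega :: "nat \<Rightarrow> tm" where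
  "Omega j = Sig (Univ j) (is_prop (Var 0))"

text \<open>The underlying type of an element of \<open>Omega j\<close>, that is, its first projection.\<close>

definition holds :: "nat \<Rightarrow> tm \<Rightarrow> tm" where
  "holds j P = IndSig (Univ j) (Var 1) P"

text \<open>
  A context lists the types of its variables, the most recent one first, so the type at position
  \<open>n\<close> lives in the context of the entries after it.
\<close>

inductive
  ctx :: "tm list \<Rightarrow> bool" and
  typed :: "tm list \<Rightarrow> tm \<Rightarrow> tm \<Rightarrow> bool"  ("_ \<turnstile> _ \<^bold>: _" [51, 51, 51] 50) and
  eqtyped :: "tm list \<Rightarrow> tm \<Rightarrow> tm \<Rightarrow> tm \<Rightarrow> bool"  ("_ \<turnstile> _ \<^bold>= _ \<^bold>: _" [51, 51, 51, 51] 50)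
where
  ctx_nil: "ctx []"
| ctx_cons: "\<Gamma> \<turnstile> A \<^bold>: Univ i \<Longrightarrow> ctx (A # \<Gamma>)"

| var: "ctx \<Gamma> \<Longrightarrow> n < length \<Gamma> \<Longrightarrow> \<Gamma> \<turnstile> Var n \<^bold>: wk (Suc n) (\<Gamma> ! n)"
| eq_refl: "\<Gamma> \<turnstile> a \<^bold>: A \<Longrightarrow> \<Gamma> \<turnstile> a \<^bold>= a \<^bold>: A"
| eq_sym: "\<Gamma> \<turnstile> a \<^bold>= b \<^bold>: A \<Longrightarrow> \<Gamma> \<turnstile> b \<^bold>= a \<^bold>: A"
| eq_trans: "\<Gamma> \<turnstile> a \<^bold>= b \<^bold>: A \<Longrightarrow> \<Gamma> \<turnstile> b \<^bold>= c \<^bold>: A \<Longrightarrow> \<Gamma> \<turnstile> a \<^bold>= c \<^bold>: A"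
| conv: "\<Gamma> \<turnstile> a \<^bold>: A \<Longrightarrow> \<Gamma> \<turnstile> A \<^bold>= B \<^bold>: Univ i \<Longrightarrow> \<Gamma> \<turnstile> a \<^bold>: B"
| eq_conv: "\<Gamma> \<turnstile> a \<^bold>= b \<^bold>: A \<Longrightarrow> \<Gamma> \<turnstile> A \<^bold>= B \<^bold>: Univ i \<Longrightarrow> \<Gamma> \<turnstile> a \<^bold>= b \<^bold>: B"

| univ: "ctx \<Gamma> \<Longrightarrow> \<Gamma> \<turnstile> Univ i \<^bold>: Univ (Suc i)"
| cumul: "\<Gamma> \<turnstile> A \<^bold>: Univ i \<Longrightarrow> \<Gamma> \<turnstile> A \<^bold>: Univ (Suc i)"
| eq_cumul: "\<Gamma> \<turnstile> A \<^bold>= B \<^bold>: Univ i \<Longrightarrow> \<Gamma> \<turnstile> A \<^bold>= B \<^bold>: Univ (Suc i)"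

| pi_form: "\<Gamma> \<turnstile> A \<^bold>: Univ i \<Longrightarrow> A # \<Gamma> \<turnstile> B \<^bold>: Univ i \<Longrightarrow> \<Gamma> \<turnstile> Pi A B \<^bold>: Univ i"
| pi_form_eq: "\<Gamma> \<turnstile> A \<^bold>: Univ i \<Longrightarrow> \<Gamma> \<turnstile> A \<^bold>= A' \<^bold>: Univ i \<Longrightarrow> A # \<Gamma> \<turnstile> B \<^bold>= B' \<^bold>: Univ i \<Longrightarrow>
    \<Gamma> \<turnstile> Pi A B \<^bold>= Pi A' B' \<^bold>: Univ i"
| lam: "\<Gamma> \<turnstile> A \<^bold>: Univ i \<Longrightarrow> A # \<Gamma> \<turnstile> b \<^bold>: B \<Longrightarrow> \<Gamma> \<turnstile> Lam A b \<^bold>: Pi A B"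
| lam_eq: "\<Gamma> \<turnstile> A \<^bold>: Univ i \<Longrightarrow> \<Gamma> \<turnstile> A \<^bold>= A' \<^bold>: Univ i \<Longrightarrow> A # \<Gamma> \<turnstile> b \<^bold>= b' \<^bold>: B \<Longrightarrow>
    \<Gamma> \<turnstile> Lam A b \<^bold>= Lam A' b' \<^bold>: Pi A B"
| app: "\<Gamma> \<turnstile> f \<^bold>: Pi A B \<Longrightarrow> \<Gamma> \<turnstile> a \<^bold>: A \<Longrightarrow> \<Gamma> \<turnstile> App f a \<^bold>: subst (a \<cdot> Var) B"
| app_eq: "\<Gamma> \<turnstile> f \<^bold>= f' \<^bold>: Pi A B \<Longrightarrow> \<Gamma> \<turnstile> a \<^bold>= a' \<^bold>: A \<Longrightarrow>
    \<Gamma> \<turnstile> App f a \<^bold>= App f' a' \<^bold>: subst (a \<cdot> Var) B"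
| pi_beta: "A # \<Gamma> \<turnstile> b \<^bold>: B \<Longrightarrow> \<Gamma> \<turnstile> a \<^bold>: A \<Longrightarrow>
    \<Gamma> \<turnstile> App (Lam A b) a \<^bold>= subst (a \<cdot> Var) b \<^bold>: subst (a \<cdot> Var) B"
| pi_eta: "\<Gamma> \<turnstile> f \<^bold>: Pi A B \<Longrightarrow> \<Gamma> \<turnstile> f \<^bold>= Lam A (App (wk 1 f) (Var 0)) \<^bold>: Pi A B"

| sig_form: "\<Gamma> \<turnstile> A \<^bold>: Univ i \<Longrightarrow> A # \<Gamma> \<turnstile> B \<^bold>: Univ i \<Longrightarrow> \<Gamma> \<turnstile> Sig A B \<^bold>: Univ i"
| sig_form_eq: "\<Gamma> \<turnstile> A \<^bold>: Univ i \<Longrightarrow> \<Gamma> \<turnstile> A \<^bold>= A' \<^bold>: Univ i \<Longrightarrow> A # \<Gamma> \<turnstile> B \<^bold>= B' \<^bold>: Univ i \<Longrightarrow>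
    \<Gamma> \<turnstile> Sig A B \<^bold>= Sig A' B' \<^bold>: Univ i"
| pair: "A # \<Gamma> \<turnstile> B \<^bold>: Univ i \<Longrightarrow> \<Gamma> \<turnstile> a \<^bold>: A \<Longrightarrow> \<Gamma> \<turnstile> b \<^bold>: subst (a \<cdot> Var) B \<Longrightarrow>
    \<Gamma> \<turnstile> Pair a b \<^bold>: Sig A B"
| pair_eq: "A # \<Gamma> \<turnstile> B \<^bold>: Univ i \<Longrightarrow> \<Gamma> \<turnstile> a \<^bold>= a' \<^bold>: A \<Longrightarrow>
    \<Gamma> \<turnstile> b \<^bold>= b' \<^bold>: subst (a \<cdot> Var) B \<Longrightarrow> \<Gamma> \<turnstile> Pair a b \<^bold>= Pair a' b' \<^bold>: Sig A B"
| ind_sig: "Sig A B # \<Gamma> \<turnstile> C \<^bold>: Univ i \<Longrightarrow>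
    B # A # \<Gamma> \<turnstile> g \<^bold>: subst (Pair (Var 1) (Var 0) \<cdot> (\<lambda>n. Var (n + 2))) C \<Longrightarrow>
    \<Gamma> \<turnstile> p \<^bold>: Sig A B \<Longrightarrow> \<Gamma> \<turnstile> IndSig C g p \<^bold>: subst (p \<cdot> Var) C"
| ind_sig_eq: "Sig A B # \<Gamma> \<turnstile> C \<^bold>= C' \<^bold>: Univ i \<Longrightarrow>
    B # A # \<Gamma> \<turnstile> g \<^bold>= g' \<^bold>: subst (Pair (Var 1) (Var 0) \<cdot> (\<lambda>n. Var (n + 2))) C \<Longrightarrow>
    \<Gamma> \<turnstile> p \<^bold>= p' \<^bold>: Sig A B \<Longrightarrow> \<Gamma> \<turnstile> IndSig C g p \<^bold>= IndSig C' g' p' \<^bold>: subst (p \<cdot> Var) C"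
| sig_beta: "Sig A B # \<Gamma> \<turnstile> C \<^bold>: Univ i \<Longrightarrow>
    B # A # \<Gamma> \<turnstile> g \<^bold>: subst (Pair (Var 1) (Var 0) \<cdot> (\<lambda>n. Var (n + 2))) C \<Longrightarrow>
    \<Gamma> \<turnstile> a \<^bold>: A \<Longrightarrow> \<Gamma> \<turnstile> b \<^bold>: subst (a \<cdot> Var) B \<Longrightarrow>
    \<Gamma> \<turnstile> IndSig C g (Pair a b) \<^bold>= subst (b \<cdot> a \<cdot> Var) g \<^bold>: subst (Pair a b \<cdot> Var) C"

| sum_form: "\<Gamma> \<turnstile> A \<^bold>: Univ i \<Longrightarrow> \<Gamma> \<turnstile> B \<^bold>: Univ i \<Longrightarrow> \<Gamma> \<turnstile> Sum A B \<^bold>: Univ i"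
| sum_form_eq: "\<Gamma> \<turnstile> A \<^bold>= A' \<^bold>: Univ i \<Longrightarrow> \<Gamma> \<turnstile> B \<^bold>= B' \<^bold>: Univ i \<Longrightarrow>
    \<Gamma> \<turnstile> Sum A B \<^bold>= Sum A' B' \<^bold>: Univ i"
| inl: "\<Gamma> \<turnstile> B \<^bold>: Univ i \<Longrightarrow> \<Gamma> \<turnstile> a \<^bold>: A \<Longrightarrow> \<Gamma> \<turnstile> Inl a \<^bold>: Sum A B"
| inl_eq: "\<Gamma> \<turnstile> B \<^bold>: Univ i \<Longrightarrow> \<Gamma> \<turnstile> a \<^bold>= a' \<^bold>: A \<Longrightarrow> \<Gamma> \<turnstile> Inl a \<^bold>= Inl a' \<^bold>: Sum A B"
| inr: "\<Gamma> \<turnstile> A \<^bold>: Univ i \<Longrightarrow> \<Gamma> \<turnstile> b \<^bold>: B \<Longrightarrow> \<Gamma> \<turnstile> Inr b \<^bold>: Sum A B"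
| inr_eq: "\<Gamma> \<turnstile> A \<^bold>: Univ i \<Longrightarrow> \<Gamma> \<turnstile> b \<^bold>= b' \<^bold>: B \<Longrightarrow> \<Gamma> \<turnstile> Inr b \<^bold>= Inr b' \<^bold>: Sum A B"
| ind_sum: "Sum A B # \<Gamma> \<turnstile> C \<^bold>: Univ i \<Longrightarrow>
    A # \<Gamma> \<turnstile> c \<^bold>: subst (Inl (Var 0) \<cdot> (\<lambda>n. Var (n + 1))) C \<Longrightarrow>
    B # \<Gamma> \<turnstile> d \<^bold>: subst (Inr (Var 0) \<cdot> (\<lambda>n. Var (n + 1))) C \<Longrightarrow>
    \<Gamma> \<turnstile> e \<^bold>: Sum A B \<Longrightarrow> \<Gamma> \<turnstile> IndSum C c d e \<^bold>: subst (e \<cdot> Var) C"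
| ind_sum_eq: "Sum A B # \<Gamma> \<turnstile> C \<^bold>= C' \<^bold>: Univ i \<Longrightarrow>
    A # \<Gamma> \<turnstile> c \<^bold>= c' \<^bold>: subst (Inl (Var 0) \<cdot> (\<lambda>n. Var (n + 1))) C \<Longrightarrow>
    B # \<Gamma> \<turnstile> d \<^bold>= d' \<^bold>: subst (Inr (Var 0) \<cdot> (\<lambda>n. Var (n + 1))) C \<Longrightarrow>
    \<Gamma> \<turnstile> e \<^bold>= e' \<^bold>: Sum A B \<Longrightarrow>
    \<Gamma> \<turnstile> IndSum C c d e \<^bold>= IndSum C' c' d' e' \<^bold>: subst (e \<cdot> Var) C"
| sum_beta_l: "Sum A B # \<Gamma> \<turnstile> C \<^bold>: Univ i \<Longrightarrow>
    A # \<Gamma> \<turnstile> c \<^bold>: subst (Inl (Var 0) \<cdot> (\<lambda>n. Var (n + 1))) C \<Longrightarrow>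
    B # \<Gamma> \<turnstile> d \<^bold>: subst (Inr (Var 0) \<cdot> (\<lambda>n. Var (n + 1))) C \<Longrightarrow>
    \<Gamma> \<turnstile> a \<^bold>: A \<Longrightarrow>
    \<Gamma> \<turnstile> IndSum C c d (Inl a) \<^bold>= subst (a \<cdot> Var) c \<^bold>: subst (Inl a \<cdot> Var) C"
| sum_beta_r: "Sum A B # \<Gamma> \<turnstile> C \<^bold>: Univ i \<Longrightarrow>
    A # \<Gamma> \<turnstile> c \<^bold>: subst (Inl (Var 0) \<cdot> (\<lambda>n. Var (n + 1))) C \<Longrightarrow>
    B # \<Gamma> \<turnstile> d \<^bold>: subst (Inr (Var 0) \<cdot> (\<lambda>n. Var (n + 1))) C \<Longrightarrow>
    \<Gamma> \<turnstile> b \<^bold>: B \<Longrightarrow>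
    \<Gamma> \<turnstile> IndSum C c d (Inr b) \<^bold>= subst (b \<cdot> Var) d \<^bold>: subst (Inr b \<cdot> Var) C"

| empty_form: "ctx \<Gamma> \<Longrightarrow> \<Gamma> \<turnstile> Empty \<^bold>: Univ i"
| ind_empty: "Empty # \<Gamma> \<turnstile> C \<^bold>: Univ i \<Longrightarrow> \<Gamma> \<turnstile> e \<^bold>: Empty \<Longrightarrow>
    \<Gamma> \<turnstile> IndEmpty C e \<^bold>: subst (e \<cdot> Var) C"
| ind_empty_eq: "Empty # \<Gamma> \<turnstile> C \<^bold>= C' \<^bold>: Univ i \<Longrightarrow> \<Gamma> \<turnstile> e \<^bold>= e' \<^bold>: Empty \<Longrightarrow>
    \<Gamma> \<turnstile> IndEmpty C e \<^bold>= IndEmpty C' e' \<^bold>: subst (e \<cdot> Var) C"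

| one_form: "ctx \<Gamma> \<Longrightarrow> \<Gamma> \<turnstile> One \<^bold>: Univ i"
| star: "ctx \<Gamma> \<Longrightarrow> \<Gamma> \<turnstile> Star \<^bold>: One"
| ind_one: "One # \<Gamma> \<turnstile> C \<^bold>: Univ i \<Longrightarrow> \<Gamma> \<turnstile> c \<^bold>: subst (Star \<cdot> Var) C \<Longrightarrow> \<Gamma> \<turnstile> e \<^bold>: One \<Longrightarrow>
    \<Gamma> \<turnstile> IndOne C c e \<^bold>: subst (e \<cdot> Var) C"
| ind_one_eq: "One # \<Gamma> \<turnstile> C \<^bold>= C' \<^bold>: Univ i \<Longrightarrow> \<Gamma> \<turnstile> c \<^bold>= c' \<^bold>: subst (Star \<cdot> Var) C \<Longrightarrow>
    \<Gamma> \<turnstile> e \<^bold>= e' \<^bold>: One \<Longrightarrow> \<Gamma> \<turnstile> IndOne C c e \<^bold>= IndOne C' c' e' \<^bold>: subst (e \<cdot> Var) C"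
| one_beta: "One # \<Gamma> \<turnstile> C \<^bold>: Univ i \<Longrightarrow> \<Gamma> \<turnstile> c \<^bold>: subst (Star \<cdot> Var) C \<Longrightarrow>
    \<Gamma> \<turnstile> IndOne C c Star \<^bold>= c \<^bold>: subst (Star \<cdot> Var) C"

| nat_form: "ctx \<Gamma> \<Longrightarrow> \<Gamma> \<turnstile> NatT \<^bold>: Univ i"
| zero: "ctx \<Gamma> \<Longrightarrow> \<Gamma> \<turnstile> Zero \<^bold>: NatT"
| succ: "\<Gamma> \<turnstile> n \<^bold>: NatT \<Longrightarrow> \<Gamma> \<turnstile> Succ n \<^bold>: NatT"
| succ_eq: "\<Gamma> \<turnstile> n \<^bold>= n' \<^bold>: NatT \<Longrightarrow> \<Gamma> \<turnstile> Succ n \<^bold>= Succ n' \<^bold>: NatT"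
| ind_nat: "NatT # \<Gamma> \<turnstile> C \<^bold>: Univ i \<Longrightarrow> \<Gamma> \<turnstile> c \<^bold>: subst (Zero \<cdot> Var) C \<Longrightarrow>
    C # NatT # \<Gamma> \<turnstile> s \<^bold>: subst (Succ (Var 1) \<cdot> (\<lambda>n. Var (n + 2))) C \<Longrightarrow>
    \<Gamma> \<turnstile> n \<^bold>: NatT \<Longrightarrow> \<Gamma> \<turnstile> IndNat C c s n \<^bold>: subst (n \<cdot> Var) C"
| ind_nat_eq: "NatT # \<Gamma> \<turnstile> C \<^bold>= C' \<^bold>: Univ i \<Longrightarrow> \<Gamma> \<turnstile> c \<^bold>= c' \<^bold>: subst (Zero \<cdot> Var) C \<Longrightarrow>
    C # NatT # \<Gamma> \<turnstile> s \<^bold>= s' \<^bold>: subst (Succ (Var 1) \<cdot> (\<lambda>n. Var (n + 2))) C \<Longrightarrow>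
    \<Gamma> \<turnstile> n \<^bold>= n' \<^bold>: NatT \<Longrightarrow> \<Gamma> \<turnstile> IndNat C c s n \<^bold>= IndNat C' c' s' n' \<^bold>: subst (n \<cdot> Var) C"
| nat_beta_zero: "NatT # \<Gamma> \<turnstile> C \<^bold>: Univ i \<Longrightarrow> \<Gamma> \<turnstile> c \<^bold>: subst (Zero \<cdot> Var) C \<Longrightarrow>
    C # NatT # \<Gamma> \<turnstile> s \<^bold>: subst (Succ (Var 1) \<cdot> (\<lambda>n. Var (n + 2))) C \<Longrightarrow>
    \<Gamma> \<turnstile> IndNat C c s Zero \<^bold>= c \<^bold>: subst (Zero \<cdot> Var) C"
| nat_beta_succ: "NatT # \<Gamma> \<turnstile> C \<^bold>: Univ i \<Longrightarrow> \<Gamma> \<turnstile> c \<^bold>: subst (Zero \<cdot> Var) C \<Longrightarrow>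
    C # NatT # \<Gamma> \<turnstile> s \<^bold>: subst (Succ (Var 1) \<cdot> (\<lambda>n. Var (n + 2))) C \<Longrightarrow>
    \<Gamma> \<turnstile> n \<^bold>: NatT \<Longrightarrow>
    \<Gamma> \<turnstile> IndNat C c s (Succ n) \<^bold>= subst (IndNat C c s n \<cdot> n \<cdot> Var) s \<^bold>: subst (Succ n \<cdot> Var) C"

| eq_form: "\<Gamma> \<turnstile> A \<^bold>: Univ i \<Longrightarrow> \<Gamma> \<turnstile> a \<^bold>: A \<Longrightarrow> \<Gamma> \<turnstile> b \<^bold>: A \<Longrightarrow> \<Gamma> \<turnstile> Eq A a b \<^bold>: Univ i"
| eq_form_eq: "\<Gamma> \<turnstile> A \<^bold>= A' \<^bold>: Univ i \<Longrightarrow> \<Gamma> \<turnstile> a \<^bold>= a' \<^bold>: A \<Longrightarrow> \<Gamma> \<turnstile> b \<^bold>= b' \<^bold>: A \<Longrightarrow>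
    \<Gamma> \<turnstile> Eq A a b \<^bold>= Eq A' a' b' \<^bold>: Univ i"
| refl: "\<Gamma> \<turnstile> a \<^bold>: A \<Longrightarrow> \<Gamma> \<turnstile> Refl a \<^bold>: Eq A a a"
| refl_eq: "\<Gamma> \<turnstile> a \<^bold>= a' \<^bold>: A \<Longrightarrow> \<Gamma> \<turnstile> Refl a \<^bold>= Refl a' \<^bold>: Eq A a a"
| ind_eq: "Eq (wk 2 A) (Var 1) (Var 0) # wk 1 A # A # \<Gamma> \<turnstile> C \<^bold>: Univ i \<Longrightarrow>
    A # \<Gamma> \<turnstile> c \<^bold>: subst (Refl (Var 0) \<cdot> Var 0 \<cdot> Var 0 \<cdot> (\<lambda>n. Var (n + 1))) C \<Longrightarrow>
    \<Gamma> \<turnstile> a \<^bold>: A \<Longrightarrow> \<Gamma> \<turnstile> b \<^bold>: A \<Longrightarrow> \<Gamma> \<turnstile> p \<^bold>: Eq A a b \<Longrightarrow>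
    \<Gamma> \<turnstile> IndEq C c a b p \<^bold>: subst (p \<cdot> b \<cdot> a \<cdot> Var) C"
| ind_eq_eq: "Eq (wk 2 A) (Var 1) (Var 0) # wk 1 A # A # \<Gamma> \<turnstile> C \<^bold>= C' \<^bold>: Univ i \<Longrightarrow>
    A # \<Gamma> \<turnstile> c \<^bold>= c' \<^bold>: subst (Refl (Var 0) \<cdot> Var 0 \<cdot> Var 0 \<cdot> (\<lambda>n. Var (n + 1))) C \<Longrightarrow>
    \<Gamma> \<turnstile> a \<^bold>= a' \<^bold>: A \<Longrightarrow> \<Gamma> \<turnstile> b \<^bold>= b' \<^bold>: A \<Longrightarrow> \<Gamma> \<turnstile> p \<^bold>= p' \<^bold>: Eq A a b \<Longrightarrow>
    \<Gamma> \<turnstile> IndEq C c a b p \<^bold>= IndEq C' c' a' b' p' \<^bold>: subst (p \<cdot> b \<cdot> a \<cdot> Var) C"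
| eq_beta: "Eq (wk 2 A) (Var 1) (Var 0) # wk 1 A # A # \<Gamma> \<turnstile> C \<^bold>: Univ i \<Longrightarrow>
    A # \<Gamma> \<turnstile> c \<^bold>: subst (Refl (Var 0) \<cdot> Var 0 \<cdot> Var 0 \<cdot> (\<lambda>n. Var (n + 1))) C \<Longrightarrow>
    \<Gamma> \<turnstile> a \<^bold>: A \<Longrightarrow>
    \<Gamma> \<turnstile> IndEq C c a a (Refl a) \<^bold>= subst (a \<cdot> Var) c \<^bold>: subst (Refl a \<cdot> a \<cdot> a \<cdot> Var) C"

(* Propositional truncation: A \<rightarrow> ||A||, ||A|| is a proposition, and ||A|| \<rightarrow> B for every proposition B
   with A \<rightarrow> B.  There is no judgemental computation rule for TrRec: the propositional one follows
   because B is a proposition. *)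
| trunc_form: "\<Gamma> \<turnstile> A \<^bold>: Univ i \<Longrightarrow> \<Gamma> \<turnstile> Trunc A \<^bold>: Univ i"
| trunc_form_eq: "\<Gamma> \<turnstile> A \<^bold>= A' \<^bold>: Univ i \<Longrightarrow> \<Gamma> \<turnstile> Trunc A \<^bold>= Trunc A' \<^bold>: Univ i"
| tr_in: "\<Gamma> \<turnstile> a \<^bold>: A \<Longrightarrow> \<Gamma> \<turnstile> TrIn a \<^bold>: Trunc A"
| tr_in_eq: "\<Gamma> \<turnstile> a \<^bold>= a' \<^bold>: A \<Longrightarrow> \<Gamma> \<turnstile> TrIn a \<^bold>= TrIn a' \<^bold>: Trunc A"
| tr_eq: "\<Gamma> \<turnstile> a \<^bold>: Trunc A \<Longrightarrow> \<Gamma> \<turnstile> b \<^bold>: Trunc A \<Longrightarrow> \<Gamma> \<turnstile> TrEq a b \<^bold>: Eq (Trunc A) a b"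
| tr_eq_eq: "\<Gamma> \<turnstile> a \<^bold>= a' \<^bold>: Trunc A \<Longrightarrow> \<Gamma> \<turnstile> b \<^bold>= b' \<^bold>: Trunc A \<Longrightarrow>
    \<Gamma> \<turnstile> TrEq a b \<^bold>= TrEq a' b' \<^bold>: Eq (Trunc A) a b"
| tr_rec: "\<Gamma> \<turnstile> B \<^bold>: Univ i \<Longrightarrow> \<Gamma> \<turnstile> h \<^bold>: is_prop B \<Longrightarrow> \<Gamma> \<turnstile> f \<^bold>: Arr A B \<Longrightarrow> \<Gamma> \<turnstile> e \<^bold>: Trunc A \<Longrightarrow>
    \<Gamma> \<turnstile> TrRec B h f e \<^bold>: B"
| tr_rec_eq: "\<Gamma> \<turnstile> B \<^bold>= B' \<^bold>: Univ i \<Longrightarrow> \<Gamma> \<turnstile> h \<^bold>= h' \<^bold>: is_prop B \<Longrightarrow>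
    \<Gamma> \<turnstile> f \<^bold>= f' \<^bold>: Arr A B \<Longrightarrow> \<Gamma> \<turnstile> e \<^bold>= e' \<^bold>: Trunc A \<Longrightarrow>
    \<Gamma> \<turnstile> TrRec B h f e \<^bold>= TrRec B' h' f' e' \<^bold>: B"

| funext: "\<Gamma> \<turnstile> f \<^bold>: Pi A B \<Longrightarrow> \<Gamma> \<turnstile> g \<^bold>: Pi A B \<Longrightarrow>
    \<Gamma> \<turnstile> h \<^bold>: Pi A (Eq B (App (wk 1 f) (Var 0)) (App (wk 1 g) (Var 0))) \<Longrightarrow>
    \<Gamma> \<turnstile> Funext f g h \<^bold>: Eq (Pi A B) f g"
| funext_eq: "\<Gamma> \<turnstile> f \<^bold>= f' \<^bold>: Pi A B \<Longrightarrow> \<Gamma> \<turnstile> g \<^bold>= g' \<^bold>: Pi A B \<Longrightarrow>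
    \<Gamma> \<turnstile> h \<^bold>= h' \<^bold>: Pi A (Eq B (App (wk 1 f) (Var 0)) (App (wk 1 g) (Var 0))) \<Longrightarrow>
    \<Gamma> \<turnstile> Funext f g h \<^bold>= Funext f' g' h' \<^bold>: Eq (Pi A B) f g"

definition inhabited :: "tm \<Rightarrow> bool" where
  "inhabited A \<longleftrightarrow> (\<exists>t. [] \<turnstile> t \<^bold>: A)"

text \<open>
  In the following definitions \<open>X\<close> and \<open>R\<close> are terms over the ambient context, with \<open>X : U\<^sub>i\<close> and
  \<open>R : X \<rightarrow> X \<rightarrow> Omega j\<close>; they are weakened whenever they occur below binders.
\<close>

definition Rel :: "nat \<Rightarrow> tm \<Rightarrow> tm" where
  "Rel j X = Arr X (Arr X (Omega j))"

definition related :: "nat \<Rightarrow> tm \<Rightarrow> tm \<Rightarrow> tm \<Rightarrow> tm" where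
  "related j R x y = holds j (App (App R x) y)"

definition decidable_equality :: "tm \<Rightarrow> tm" where
  "decidable_equality X = Pi X (Pi (wk 1 X) (Dec (Eq (wk 2 X) (Var 1) (Var 0))))"

text \<open>\<open>\<Pi> x y z : X. x R y \<rightarrow> x R z \<rightarrow> y = z\<close>\<close>

definition single_valued_rel :: "nat \<Rightarrow> tm \<Rightarrow> tm \<Rightarrow> tm" where
  "single_valued_rel j X R = Pi X (Pi (wk 1 X) (Pi (wk 2 X)
     (Arr (related j (wk 3 R) (Var 2) (Var 1))
     (Arr (related j (wk 3 R) (Var 2) (Var 0))
       (Eq (wk 3 X) (Var 1) (Var 0))))))"

text \<open>\<open>\<Pi> x : X. Dec (\<Sigma> y : X. x R y)\<close>\<close>

definition decidable_domain :: "nat \<Rightarrow> tm \<Rightarrow> tm \<Rightarrow> tm" where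
  "decidable_domain j X R = Pi X (Dec (Sig (wk 1 X) (related j (wk 2 R) (Var 1) (Var 0))))"

text \<open>
  The family \<open>k \<mapsto> R\<^sub>k : X \<rightarrow> X \<rightarrow> U\<^sub>m\<close>, by recursion on \<open>k\<close>.  Its base is \<open>\<lambda>x y. x = y\<close> and its step
  sends \<open>S\<close> (the variable 3 at its place of use) to \<open>\<lambda>x z. \<Sigma> y : X. x R y \<times> S y z\<close>.
  As \<open>X : U\<^sub>i\<close> and \<open>x R y : U\<^sub>j\<close>, all these types lie in \<open>U\<^sub>m\<close> for \<open>m = max i j\<close>.
\<close>

definition step_rel :: "nat \<Rightarrow> nat \<Rightarrow> tm \<Rightarrow> tm \<Rightarrow> tm \<Rightarrow> tm" where
  "step_rel i j X R k = IndNat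
     (Arr (wk 1 X) (Arr (wk 1 X) (Univ (max i j))))
     (Lam X (Lam (wk 1 X) (Eq (wk 2 X) (Var 1) (Var 0))))
     (Lam (wk 2 X) (Lam (wk 3 X)
       (Sig (wk 4 X)
         (Times (related j (wk 5 R) (Var 2) (Var 0)) (App (App (Var 3) (Var 0)) (Var 1))))))
     k"

definition step_closure :: "nat \<Rightarrow> nat \<Rightarrow> tm \<Rightarrow> tm \<Rightarrow> tm \<Rightarrow> tm \<Rightarrow> tm \<Rightarrow> tm" where
  "step_closure i j X R k x y = Trunc (App (App (step_rel i j X R k) x) y)"

text \<open>\<open>\<Pi> (k : Nat) (x y : X). Dec (x R\<^sup>k y)\<close>\<close>

definition decidable_closures :: "nat \<Rightarrow> nat \<Rightarrow> tm \<Rightarrow> tm \<Rightarrow> tm" where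
  "decidable_closures i j X R = Pi NatT (Pi (wk 1 X) (Pi (wk 2 X)
     (Dec (step_closure i j (wk 3 X) (wk 3 R) (Var 2) (Var 1) (Var 0)))))"

end

theory Submission
  imports Defs "HOL-Library.Monad_Syntax"
begin

text \<open>
  By induction on \<open>k\<close>.  Decidability of \<open>A\<close> passes to \<open>\<parallel>A\<parallel>\<close>, because the empty type is a proposition;
  this settles \<open>k = 0\<close>.  For the step, decide whether \<open>x\<close> has an \<open>R\<close>-successor.  If not, no
  \<open>(k+1)\<close>-step chain leaves \<open>x\<close>.  If \<open>x R y\<close>, then single-valuedness makes every successor of \<open>x\<close> equal
  to \<open>y\<close>, so \<open>\<Sigma> y'. x R y' \<times> y' R\<^sub>k z\<close> and \<open>y R\<^sub>k z\<close> imply each other, and the truncation of the latter is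
  decidable by hypothesis.

  The proof terms are closed and typed by computation.  Soundness of a conversion-free type checker
  needs no metatheory (substitution, regularity), and conversion is used only at the recursion
  equations of \<open>R\<^sub>k\<close>.
\<close>

subsection \<open>A type checker\<close>

fun as_univ :: "tm \<Rightarrow> nat option" where
  "as_univ (Univ i) = Some i"
| "as_univ _ = None"

fun as_pi :: "tm \<Rightarrow> (tm \<times> tm) option" where
  "as_pi (Pi A B) = Some (A, B)"
| "as_pi _ = None"

fun as_sig :: "tm \<Rightarrow> (tm \<times> tm) option" where
  "as_sig (Sig A B) = Some (A, B)"
| "as_sig _ = None"

fun as_sum :: "tm \<Rightarrow> (tm \<times> tm) option" where
  "as_sum (Sum A B) = Some (A, B)"
| "as_sum _ = None"

fun as_trunc :: "tm \<Rightarrow> tm option" where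
  "as_trunc (Trunc A) = Some A"
| "as_trunc _ = None"

lemma as_univ_iff: "as_univ T = Some i \<longleftrightarrow> T = Univ i"
  by (cases T) auto

lemma as_pi_iff: "as_pi T = Some (A, B) \<longleftrightarrow> T = Pi A B"
  by (cases T) auto

lemma as_sig_iff: "as_sig T = Some (A, B) \<longleftrightarrow> T = Sig A B"
  by (cases T) auto

lemma as_sum_iff: "as_sum T = Some (A, B) \<longleftrightarrow> T = Sum A B"
  by (cases T) auto

lemma as_trunc_iff: "as_trunc T = Some A \<longleftrightarrow> T = Trunc A"
  by (cases T) auto

definition require :: "bool \<Rightarrow> unit option" where
  "require b = (if b then Some () else None)"

lemma require_iff: "require b = Some u \<longleftrightarrow> b"
  by (simp add: require_def)

lemma require_True [simp]: "require True = Some ()"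
  by (simp add: require_def)

text \<open>Cumulativity is tested only between universes themselves, not below type formers,
  because \<open>cumul\<close> merely raises the universe that contains a type.\<close>

definition fits :: "tm \<Rightarrow> tm \<Rightarrow> bool" where
  "fits T T' \<longleftrightarrow> T = T' \<or> (\<exists>k l. T = Univ k \<and> T' = Univ l \<and> k \<le> l)"

lemma fits_refl [simp]: "fits T T"
  by (simp add: fits_def)

lemma fits_Univ [simp]: "fits (Univ k) (Univ l) \<longleftrightarrow> k \<le> l"
  by (auto simp: fits_def)

definition expect :: "tm option \<Rightarrow> tm \<Rightarrow> tm option" where
  "expect E T = (case E of None \<Rightarrow> Some T | Some T' \<Rightarrow> if fits T T' then E else None)"

lemma expect_None [simp]: "expect None T = Some T"
  by (simp add: expect_def)

lemma expect_Some [simp]: "expect (Some T') T = (if fits T T' then Some T' else None)"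
  by (simp add: expect_def)

text \<open>
  Bidirectional checking: \<open>E\<close> is the expected type, or \<open>None\<close> when the type is to be inferred.
  There is no conversion: up to cumulativity, types must agree syntactically.  \<open>Pair\<close>, \<open>Inl\<close>, \<open>Inr\<close>
  and some eliminators need types that are not subterms to be well formed; these go to the oracle \<open>D\<close>.
\<close>

primrec chk :: "(tm list \<Rightarrow> tm \<Rightarrow> bool) \<Rightarrow> tm \<Rightarrow> tm list \<Rightarrow> tm option \<Rightarrow> tm option" where
  "chk D (Var n) \<Gamma> E = do {
     require (n < length \<Gamma>); expect E (wk (Suc n) (\<Gamma> ! n)) }"
| "chk D (Univ i) \<Gamma> E = expect E (Univ (Suc i))"
| "chk D (Pi A B) \<Gamma> E = do {
     k \<leftarrow> chk D A \<Gamma> None \<bind> as_univ; l \<leftarrow> chk D B (A # \<Gamma>) None \<bind> as_univ;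
     expect E (Univ (max k l)) }"
| "chk D (Lam A b) \<Gamma> E = do {
     chk D A \<Gamma> None \<bind> as_univ;
     (case E of
        None \<Rightarrow> do { B \<leftarrow> chk D b (A # \<Gamma>) None; Some (Pi A B) }
      | Some T \<Rightarrow> do { (A', B) \<leftarrow> as_pi T; require (A = A'); chk D b (A # \<Gamma>) (Some B); E }) }"
| "chk D (App f a) \<Gamma> E = do {
     (A, B) \<leftarrow> chk D f \<Gamma> None \<bind> as_pi; chk D a \<Gamma> (Some A); expect E (subst (a \<cdot> Var) B) }"
| "chk D (Sig A B) \<Gamma> E = do {
     k \<leftarrow> chk D A \<Gamma> None \<bind> as_univ; l \<leftarrow> chk D B (A # \<Gamma>) None \<bind> as_univ;
     expect E (Univ (max k l)) }"
| "chk D (Pair a b) \<Gamma> E = do {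
     (A, B) \<leftarrow> E \<bind> as_sig; require (D \<Gamma> A); require (D (A # \<Gamma>) B);
     chk D a \<Gamma> (Some A); chk D b \<Gamma> (Some (subst (a \<cdot> Var) B)); E }"
| "chk D (IndSig C g p) \<Gamma> E = do {
     (A, B) \<leftarrow> chk D p \<Gamma> None \<bind> as_sig; require (D \<Gamma> A); require (D (A # \<Gamma>) B);
     require (D \<Gamma> (Sig A B)); chk D C (Sig A B # \<Gamma>) None \<bind> as_univ;
     chk D g (B # A # \<Gamma>) (Some (subst (Pair (Var 1) (Var 0) \<cdot> (\<lambda>n. Var (n + 2))) C));
     expect E (subst (p \<cdot> Var) C) }"
| "chk D (Sum A B) \<Gamma> E = do {
     k \<leftarrow> chk D A \<Gamma> None \<bind> as_univ; l \<leftarrow> chk D B \<Gamma> None \<bind> as_univ; expect E (Univ (max k l)) }"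
| "chk D (Inl a) \<Gamma> E = do {
     (A, B) \<leftarrow> E \<bind> as_sum; require (D \<Gamma> B); chk D a \<Gamma> (Some A); E }"
| "chk D (Inr b) \<Gamma> E = do {
     (A, B) \<leftarrow> E \<bind> as_sum; require (D \<Gamma> A); chk D b \<Gamma> (Some B); E }"
| "chk D (IndSum C c d e) \<Gamma> E = do {
     (A, B) \<leftarrow> chk D e \<Gamma> None \<bind> as_sum; require (D \<Gamma> A); require (D \<Gamma> B);
     require (D \<Gamma> (Sum A B)); chk D C (Sum A B # \<Gamma>) None \<bind> as_univ;
     chk D c (A # \<Gamma>) (Some (subst (Inl (Var 0) \<cdot> (\<lambda>n. Var (n + 1))) C));
     chk D d (B # \<Gamma>) (Some (subst (Inr (Var 0) \<cdot> (\<lambda>n. Var (n + 1))) C));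
     expect E (subst (e \<cdot> Var) C) }"
| "chk D Empty \<Gamma> E = expect E (Univ 0)"
| "chk D (IndEmpty C e) \<Gamma> E = do {
     chk D C (Empty # \<Gamma>) None \<bind> as_univ; chk D e \<Gamma> (Some Empty); expect E (subst (e \<cdot> Var) C) }"
| "chk D One \<Gamma> E = expect E (Univ 0)"
| "chk D Star \<Gamma> E = expect E One"
| "chk D (IndOne C c e) \<Gamma> E = do {
     chk D C (One # \<Gamma>) None \<bind> as_univ; chk D c \<Gamma> (Some (subst (Star \<cdot> Var) C));
     chk D e \<Gamma> (Some One); expect E (subst (e \<cdot> Var) C) }"
| "chk D NatT \<Gamma> E = expect E (Univ 0)"
| "chk D Zero \<Gamma> E = expect E NatT"
| "chk D (Succ n) \<Gamma> E = do { chk D n \<Gamma> (Some NatT); expect E NatT }"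
| "chk D (IndNat C c s n) \<Gamma> E = do {
     chk D C (NatT # \<Gamma>) None \<bind> as_univ; chk D c \<Gamma> (Some (subst (Zero \<cdot> Var) C));
     chk D s (C # NatT # \<Gamma>) (Some (subst (Succ (Var 1) \<cdot> (\<lambda>n. Var (n + 2))) C));
     chk D n \<Gamma> (Some NatT); expect E (subst (n \<cdot> Var) C) }"
| "chk D (Eq A a b) \<Gamma> E = do {
     i \<leftarrow> chk D A \<Gamma> None \<bind> as_univ; chk D a \<Gamma> (Some A); chk D b \<Gamma> (Some A); expect E (Univ i) }"
| "chk D (Refl a) \<Gamma> E = do { A \<leftarrow> chk D a \<Gamma> None; expect E (Eq A a a) }"
| "chk D (IndEq C c a b p) \<Gamma> E = do {
     A \<leftarrow> chk D a \<Gamma> None; require (D \<Gamma> A); require (D (A # \<Gamma>) (wk 1 A));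
     require (D (wk 1 A # A # \<Gamma>) (Eq (wk 2 A) (Var 1) (Var 0)));
     chk D C (Eq (wk 2 A) (Var 1) (Var 0) # wk 1 A # A # \<Gamma>) None \<bind> as_univ;
     chk D c (A # \<Gamma>) (Some (subst (Refl (Var 0) \<cdot> Var 0 \<cdot> Var 0 \<cdot> (\<lambda>n. Var (n + 1))) C));
     chk D b \<Gamma> (Some A); chk D p \<Gamma> (Some (Eq A a b)); expect E (subst (p \<cdot> b \<cdot> a \<cdot> Var) C) }"
| "chk D (Trunc A) \<Gamma> E = do { i \<leftarrow> chk D A \<Gamma> None \<bind> as_univ; expect E (Univ i) }"
| "chk D (TrIn a) \<Gamma> E = do { A \<leftarrow> chk D a \<Gamma> None; expect E (Trunc A) }"
| "chk D (TrEq a b) \<Gamma> E = do {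
     A \<leftarrow> chk D a \<Gamma> None \<bind> as_trunc; chk D b \<Gamma> (Some (Trunc A)); expect E (Eq (Trunc A) a b) }"
| "chk D (TrRec B h f e) \<Gamma> E = do {
     chk D B \<Gamma> None \<bind> as_univ; chk D h \<Gamma> (Some (is_prop B));
     A \<leftarrow> chk D e \<Gamma> None \<bind> as_trunc; chk D f \<Gamma> (Some (Arr A B)); expect E B }"
| "chk D (Funext f g h) \<Gamma> E = do {
     (A, B) \<leftarrow> chk D f \<Gamma> None \<bind> as_pi; chk D g \<Gamma> (Some (Pi A B));
     chk D h \<Gamma> (Some (Pi A (Eq B (App (wk 1 f) (Var 0)) (App (wk 1 g) (Var 0)))));
     expect E (Eq (Pi A B) f g) }"

section \<open>Soundness of the checker\<close>

lemma cumul_le: "\<Gamma> \<turnstile> A \<^bold>: Univ i \<Longrightarrow> i \<le> k \<Longrightarrow> \<Gamma> \<turnstile> A \<^bold>: Univ k"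
  by (rotate_tac, induction k rule: dec_induct) (auto intro: cumul)

lemma typed_fits: "\<Gamma> \<turnstile> t \<^bold>: T \<Longrightarrow> fits T T' \<Longrightarrow> \<Gamma> \<turnstile> t \<^bold>: T'"
  by (auto simp: fits_def intro: cumul_le)

lemma expect_sound: "expect E T = Some T' \<Longrightarrow> \<Gamma> \<turnstile> t \<^bold>: T \<Longrightarrow> \<Gamma> \<turnstile> t \<^bold>: T'"
  by (auto simp: expect_def intro: typed_fits split: option.splits if_splits)

text \<open>Every successful check ends in \<open>E\<close> or in \<open>expect E\<close>, and both
  return the expected type even when a smaller universe was inferred.\<close>

lemma chk_result: "chk D t \<Gamma> (Some T) = Some T' \<Longrightarrow> T' = T"
  by (cases t) (auto simp: bind_eq_Some_conv split: if_splits)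

lemmas chk_iffs = bind_eq_Some_conv require_iff as_univ_iff as_pi_iff as_sig_iff as_sum_iff as_trunc_iff

text \<open>Each case is one typing rule. The premises that types are well formed come from the
  sound oracle \<open>D\<close>, which replaces regularity.\<close>

lemma chk_sound:
  assumes D: "\<And>\<Gamma> T. D \<Gamma> T \<Longrightarrow> ctx \<Gamma> \<Longrightarrow> \<exists>i. \<Gamma> \<turnstile> T \<^bold>: Univ i"
  shows "chk D t \<Gamma> E = Some T \<Longrightarrow> ctx \<Gamma> \<Longrightarrow> \<Gamma> \<turnstile> t \<^bold>: T"
proof (induction t arbitrary: \<Gamma> E T)
  case (Var n)
  with var[of \<Gamma> n] show ?case by (auto simp: chk_iffs intro: expect_sound)
next
  case (Univ i)
  then show ?case by (auto intro: expect_sound univ)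
next
  case (Pi A B)
  then show ?case
    by (auto simp: chk_iffs elim!: expect_sound)
       (metis ctx_cons cumul_le max.cobounded1 max.cobounded2 pi_form)
next
  case (Lam A b)
  then show ?case
    by (auto simp: chk_iffs split: option.splits dest: chk_result)
       (metis chk_result ctx_cons lam)+
next
  case (App f a)
  then show ?case
    by (auto simp: chk_iffs elim!: expect_sound) (metis chk_result app)
next
  case (Sig A B)
  then show ?case
    by (auto simp: chk_iffs elim!: expect_sound)
       (metis ctx_cons cumul_le max.cobounded1 max.cobounded2 sig_form)
next
  case (Pair a b)
  then show ?case
    by (auto simp: chk_iffs) (metis chk_result ctx_cons pair D)
next
  case (IndSig C g p)
  then obtain A B i where *: "chk D p \<Gamma> None = Some (Sig A B)" "D \<Gamma> A" "D (A # \<Gamma>) B" "D \<Gamma> (Sig A B)"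
    "chk D C (Sig A B # \<Gamma>) None = Some (Univ i)"
    "chk D g (B # A # \<Gamma>) (Some (subst (Pair (Var 1) (Var 0) \<cdot> (\<lambda>n. Var (n + 2))) C)) \<noteq> None"
    "expect E (subst (p \<cdot> Var) C) = Some T"
    by (auto simp: chk_iffs)
  \<comment> \<open>Motive and branch live in extended contexts; the oracle answers make these well
    formed, so that the induction hypotheses apply.\<close>
  then have "ctx (Sig A B # \<Gamma>)" "ctx (B # A # \<Gamma>)"
    using IndSig.prems by (meson D ctx_cons)+
  with * IndSig have "\<Gamma> \<turnstile> IndSig C g p \<^bold>: subst (p \<cdot> Var) C"
    by (metis chk_result ind_sig not_None_eq)
  with * show ?case by (auto intro: expect_sound)
next
  case (Sum A B)
  then show ?case
    by (auto simp: chk_iffs elim!: expect_sound)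
       (metis cumul_le max.cobounded1 max.cobounded2 sum_form)
next
  case (Inl a)
  then show ?case
    by (auto simp: chk_iffs) (metis chk_result inl D)
next
  case (Inr b)
  then show ?case
    by (auto simp: chk_iffs) (metis chk_result inr D)
next
  case (IndSum C c d e)
  then obtain A B i where *: "chk D e \<Gamma> None = Some (Sum A B)" "D \<Gamma> A" "D \<Gamma> B" "D \<Gamma> (Sum A B)"
    "chk D C (Sum A B # \<Gamma>) None = Some (Univ i)"
    "chk D c (A # \<Gamma>) (Some (subst (Inl (Var 0) \<cdot> (\<lambda>n. Var (n + 1))) C)) \<noteq> None"
    "chk D d (B # \<Gamma>) (Some (subst (Inr (Var 0) \<cdot> (\<lambda>n. Var (n + 1))) C)) \<noteq> None"
    "expect E (subst (e \<cdot> Var) C) = Some T"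
    by (auto simp: chk_iffs)
  then have "ctx (Sum A B # \<Gamma>)" "ctx (A # \<Gamma>)" "ctx (B # \<Gamma>)"
    using IndSum.prems by (meson D ctx_cons)+
  with * IndSum have "\<Gamma> \<turnstile> IndSum C c d e \<^bold>: subst (e \<cdot> Var) C"
    by (metis chk_result ind_sum not_None_eq)
  with * show ?case by (auto intro: expect_sound)
next
  case (IndEmpty C e)
  then show ?case
    by (auto simp: chk_iffs elim!: expect_sound) (metis chk_result ctx_cons empty_form ind_empty)
next
  case (IndOne C c e)
  then show ?case
    by (auto simp: chk_iffs elim!: expect_sound) (metis chk_result ctx_cons one_form ind_one)
next
  case (Succ n)
  then show ?case
    by (auto simp: chk_iffs elim!: expect_sound) (metis chk_result succ)
next
  case (IndNat C c s n)
  then obtain i where *: "chk D C (NatT # \<Gamma>) None = Some (Univ i)"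
    "chk D c \<Gamma> (Some (subst (Zero \<cdot> Var) C)) \<noteq> None"
    "chk D s (C # NatT # \<Gamma>) (Some (subst (Succ (Var 1) \<cdot> (\<lambda>n. Var (n + 2))) C)) \<noteq> None"
    "chk D n \<Gamma> (Some NatT) \<noteq> None" "expect E (subst (n \<cdot> Var) C) = Some T"
    by (auto simp: chk_iffs)
  moreover from this IndNat have "ctx (NatT # \<Gamma>)" "ctx (C # NatT # \<Gamma>)"
    by (meson ctx_cons nat_form)+
  ultimately have "\<Gamma> \<turnstile> IndNat C c s n \<^bold>: subst (n \<cdot> Var) C"
    using IndNat.prems(2) by (intro ind_nat) (blast dest: chk_result intro: IndNat.IH)+
  with * show ?case by (auto intro: expect_sound)
next
  case (Eq A a b)
  then show ?case
    by (auto simp: chk_iffs elim!: expect_sound) (metis chk_result eq_form)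
next
  case (IndEq C c a b p)
  then obtain A i where *: "chk D a \<Gamma> None = Some A" "D \<Gamma> A" "D (A # \<Gamma>) (wk 1 A)"
    "D (wk 1 A # A # \<Gamma>) (Eq (wk 2 A) (Var 1) (Var 0))"
    "chk D C (Eq (wk 2 A) (Var 1) (Var 0) # wk 1 A # A # \<Gamma>) None = Some (Univ i)"
    "chk D c (A # \<Gamma>) (Some (subst (Refl (Var 0) \<cdot> Var 0 \<cdot> Var 0 \<cdot> (\<lambda>n. Var (n + 1))) C)) \<noteq> None"
    "chk D b \<Gamma> (Some A) \<noteq> None" "chk D p \<Gamma> (Some (Eq A a b)) \<noteq> None"
    "expect E (subst (p \<cdot> b \<cdot> a \<cdot> Var) C) = Some T"
    by (auto simp: chk_iffs)
  then have "ctx (A # \<Gamma>)" "ctx (Eq (wk 2 A) (Var 1) (Var 0) # wk 1 A # A # \<Gamma>)"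
    using IndEq.prems by (meson D ctx_cons)+
  note ctx = this
  have "\<Gamma> \<turnstile> IndEq C c a b p \<^bold>: subst (p \<cdot> b \<cdot> a \<cdot> Var) C"
  proof (rule ind_eq)
    show "Eq (wk 2 A) (Var 1) (Var 0) # wk 1 A # A # \<Gamma> \<turnstile> C \<^bold>: Univ i"
      using IndEq.IH(1) *(5) ctx(2) by blast
    show "A # \<Gamma> \<turnstile> c \<^bold>: subst (Refl (Var 0) \<cdot> Var 0 \<cdot> Var 0 \<cdot> (\<lambda>n. Var (n + 1))) C"
      using IndEq.IH(2) *(6) ctx(1) by (blast dest: chk_result)
    show "\<Gamma> \<turnstile> a \<^bold>: A" using IndEq.IH(3) *(1) IndEq.prems(2) by blast
    show "\<Gamma> \<turnstile> b \<^bold>: A" using IndEq.IH(4) *(7) IndEq.prems(2) by (blast dest: chk_result)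
    show "\<Gamma> \<turnstile> p \<^bold>: Eq A a b" using IndEq.IH(5) *(8) IndEq.prems(2) by (blast dest: chk_result)
  qed
  with * show ?case by (auto intro: expect_sound)
next
  case (TrEq a b)
  then show ?case
    by (auto simp: chk_iffs elim!: expect_sound) (metis chk_result tr_eq)
next
  case (TrRec B h f e)
  then show ?case
    by (auto simp: chk_iffs elim!: expect_sound) (metis chk_result tr_rec)
next
  case (Funext f g h)
  then obtain A B where *: "chk D f \<Gamma> None = Some (Pi A B)" "chk D g \<Gamma> (Some (Pi A B)) \<noteq> None"
    "chk D h \<Gamma> (Some (Pi A (Eq B (App (wk 1 f) (Var 0)) (App (wk 1 g) (Var 0))))) \<noteq> None"
    "expect E (Eq (Pi A B) f g) = Some T"
    by (auto simp: chk_iffs)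
  with Funext have "\<Gamma> \<turnstile> Funext f g h \<^bold>: Eq (Pi A B) f g"
    by (metis chk_result funext not_None_eq)
  with * show ?case by (auto intro: expect_sound)
next
  case (Refl a)
  then show ?case
    by (auto simp: chk_iffs elim!: expect_sound) (metis ctx_typed_eqtyped.refl)
next
  case (Trunc A)
  then show ?case
    by (auto simp: chk_iffs elim!: expect_sound) (metis trunc_form)
next
  case (TrIn a)
  then show ?case
    by (auto simp: chk_iffs elim!: expect_sound) (metis tr_in)
qed (auto elim!: expect_sound intro: empty_form one_form star nat_form zero)

text \<open>\<open>n\<close> bounds the nesting of the questions to the oracle.\<close>

primrec is_type :: "nat \<Rightarrow> tm list \<Rightarrow> tm \<Rightarrow> bool" where
  "is_type 0 \<Gamma> T = False"
| "is_type (Suc n) \<Gamma> T = ((chk (is_type n) T \<Gamma> None \<bind> as_univ) \<noteq> None)"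

text \<open>Ties the knot: soundness at depth \<open>n\<close> is the oracle hypothesis of
  \<open>chk_sound\<close> at depth \<open>Suc n\<close>, and depth 0 accepts nothing.\<close>

lemma is_type_sound: "is_type n \<Gamma> T \<Longrightarrow> ctx \<Gamma> \<Longrightarrow> \<exists>i. \<Gamma> \<turnstile> T \<^bold>: Univ i"
proof (induction n arbitrary: \<Gamma> T)
  case (Suc n)
  then obtain i where "chk (is_type n) T \<Gamma> None = Some (Univ i)"
    by (auto simp: chk_iffs)
  from chk_sound[OF Suc.IH this Suc.prems(2)] show ?case ..
qed simp

lemma chk_typed:
  assumes "ctx \<Gamma>" "chk (is_type n) t \<Gamma> E = Some T"
  shows "\<Gamma> \<turnstile> t \<^bold>: T"
  using chk_sound[OF is_type_sound assms(2,1)] .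

lemma is_type_numeral [simp]:
  "is_type (numeral n) \<Gamma> T \<longleftrightarrow> (chk (is_type (pred_numeral n)) T \<Gamma> None \<bind> as_univ) \<noteq> None"
  by (simp add: numeral_eq_Suc del: not_None_eq)

lemma ctx_step: "ctx \<Gamma> \<Longrightarrow> is_type n \<Gamma> A \<Longrightarrow> ctx (A # \<Gamma>)"
  by (meson ctx_cons is_type_sound)

text \<open>The body is assumed typed rather than checked, so that bodies whose typing needs
  conversion can be used.\<close>

lemma lam_checks:
  assumes "ctx \<Gamma>" "is_type 3 \<Gamma> A" "A # \<Gamma> \<turnstile> b \<^bold>: B"
  shows "\<Gamma> \<turnstile> Lam A b \<^bold>: Pi A B"
  using assms by (meson is_type_sound lam)

abbreviation checks :: "tm list \<Rightarrow> tm \<Rightarrow> tm \<Rightarrow> bool" where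
  "checks \<Gamma> t T \<equiv> chk (is_type 3) t \<Gamma> (Some T) = Some T"

subsection \<open>Decidability and truncation\<close>

lemmas type_defs = Arr_def Times_def Neg_def Dec_def is_prop_def Omega_def holds_def Rel_def related_def
  single_valued_rel_def decidable_domain_def

lemmas compute_defs = up_ren_def up_def fits_def

text \<open>The witness that \<open>TrRec\<close> demands for eliminating a truncation into
  \<open>Empty\<close>.\<close>

definition empty_prop :: tm where
  "empty_prop = Lam Empty (Lam Empty (IndEmpty (Eq Empty (Var 2) (Var 1)) (Var 0)))"

definition trunc_prop :: "tm \<Rightarrow> tm" where
  "trunc_prop A = Lam (Trunc A) (Lam (Trunc (wk 1 A)) (TrEq (Var 1) (Var 0)))"

definition trunc_neg :: "nat \<Rightarrow> tm" where
  "trunc_neg m = Lam (Univ m) (Lam (Neg (Var 0)) (Lam (Trunc (Var 1))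
     (TrRec Empty empty_prop (Var 1) (Var 0))))"

definition trunc_map :: "nat \<Rightarrow> tm" where
  "trunc_map m = Lam (Univ m) (Lam (Univ m) (Lam (Arr (Var 1) (Var 0)) (Lam (Trunc (Var 2))
     (TrRec (Trunc (Var 2)) (trunc_prop (Var 2)) (Lam (Var 3) (TrIn (App (Var 2) (Var 0))))
       (Var 0)))))"

definition dec_trunc :: "nat \<Rightarrow> tm" where
  "dec_trunc m = Lam (Univ m) (Lam (Dec (Var 0))
     (IndSum (Dec (Trunc (Var 2)))
       (Inl (TrIn (Var 0)))
       (Inr (App (App (trunc_neg m) (Var 2)) (Var 0)))
       (Var 0)))"

text \<open>Maps both ways suffice: \<open>trunc_map\<close> carries a positive answer forward and
  pulls a refutation back.\<close>

definition dec_trunc_iff :: "nat \<Rightarrow> tm" where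
  "dec_trunc_iff m = Lam (Univ m) (Lam (Univ m)
     (Lam (Arr (Var 1) (Var 0)) (Lam (Arr (Var 1) (Var 2)) (Lam (Dec (Trunc (Var 3)))
       (IndSum (Dec (Trunc (Var 4)))
         (Inl (App (App (App (App (trunc_map m) (Var 5)) (Var 4)) (Var 3)) (Var 0)))
         (Inr (Lam (Trunc (Var 4))
           (App (Var 1) (App (App (App (App (trunc_map m) (Var 5)) (Var 6)) (Var 3)) (Var 0)))))
         (Var 0))))))"

text \<open>The term is closed, so its type is the same in every \<open>\<Gamma>\<close>. As a
  simplification rule this lets later terms use it without rechecking its body.\<close>

lemma chk_trunc_neg [simp]:
  "chk (is_type 3) (trunc_neg m) \<Gamma> None = Some (Pi (Univ m) (Arr (Neg (Var 0)) (Neg (Trunc (Var 0)))))"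
  by (simp add: trunc_neg_def empty_prop_def type_defs compute_defs)

lemma chk_trunc_map [simp]:
  "chk (is_type 3) (trunc_map m) \<Gamma> None =
    Some (Pi (Univ m) (Pi (Univ m) (Arr (Arr (Var 1) (Var 0)) (Arr (Trunc (Var 1)) (Trunc (Var 0))))))"
  by (simp add: trunc_map_def trunc_prop_def type_defs compute_defs)

lemma chk_dec_trunc [simp]:
  "chk (is_type 3) (dec_trunc m) \<Gamma> None = Some (Pi (Univ m) (Arr (Dec (Var 0)) (Dec (Trunc (Var 0)))))"
  by (simp add: dec_trunc_def type_defs compute_defs)

lemma chk_dec_trunc_iff [simp]:
  "chk (is_type 3) (dec_trunc_iff m) \<Gamma> None = Some (Pi (Univ m) (Pi (Univ m)
     (Arr (Arr (Var 1) (Var 0)) (Arr (Arr (Var 0) (Var 1)) (Arr (Dec (Trunc (Var 1))) (Dec (Trunc (Var 0))))))))"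
  by (simp add: dec_trunc_iff_def type_defs compute_defs)

subsection \<open>One step of the closure\<close>

text \<open>Transport in the first argument of a family \<open>S\<close>, by path induction with the
  identity at \<open>Refl\<close>.\<close>

definition transport_rel :: "nat \<Rightarrow> nat \<Rightarrow> tm" where
  "transport_rel i m = Lam (Univ i) (Lam (Arr (Var 0) (Arr (Var 0) (Univ m)))
     (Lam (Var 1) (Lam (Var 2) (Lam (Var 3) (Lam (Eq (Var 4) (Var 2) (Var 1))
       (IndEq (Arr (App (App (Var 7) (Var 2)) (Var 4)) (App (App (Var 7) (Var 1)) (Var 4)))
         (Lam (App (App (Var 5) (Var 0)) (Var 2)) (Var 0))
         (Var 3) (Var 2) (Var 0)))))))"

lemma chk_transport_rel [simp]:
  "chk (is_type 3) (transport_rel i m) \<Gamma> None = Some (Pi (Univ i) (Pi (Arr (Var 0) (Arr (Var 0) (Univ m)))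
     (Pi (Var 1) (Pi (Var 2) (Pi (Var 3) (Arr (Eq (Var 4) (Var 2) (Var 1))
       (Arr (App (App (Var 3) (Var 2)) (Var 0)) (App (App (Var 3) (Var 1)) (Var 0)))))))))"
  by (simp add: transport_rel_def type_defs compute_defs)

text \<open>The body of the successor case of \<open>step_rel\<close>, with \<open>S\<close> a
  parameter: a variable in \<open>dec_step\<close>, later \<open>step_rel\<close> at the
  predecessor.\<close>

definition comp_step :: "nat \<Rightarrow> tm \<Rightarrow> tm \<Rightarrow> tm \<Rightarrow> tm \<Rightarrow> tm \<Rightarrow> tm" where
  "comp_step j X R S x z =
     Sig X (Times (related j (wk 1 R) (wk 1 x) (Var 0)) (App (App (wk 1 S) (Var 0)) (wk 1 z)))"

text \<open>
  The step from \<open>S\<close> to \<open>\<lambda>x z. \<Sigma> y : X. x R y \<times> S y z\<close>, in the context \<open>X, R, s, f, S, h, x, z\<close> with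
  \<open>s : single_valued_rel\<close>, \<open>f : decidable_domain\<close> and \<open>h : \<Pi> y z. Dec (\<parallel>S y z\<parallel>)\<close>; so \<open>z\<close> has index 0
  and \<open>X\<close> index 7, plus one for the branch variable of the case distinction on \<open>f x\<close>.
\<close>

definition dec_step_dom :: "nat \<Rightarrow> nat \<Rightarrow> tm" where
  "dec_step_dom i j =
     IndSig (Dec (Trunc (comp_step j (Var 9) (Var 8) (Var 5) (Var 3) (Var 2))))
       (App (App (App (App (App (dec_trunc_iff (max i j))
         (App (App (Var 6) (Var 1)) (Var 3)))
         (comp_step j (Var 10) (Var 9) (Var 6) (Var 4) (Var 3)))
         (Lam (App (App (Var 6) (Var 1)) (Var 3)) (Pair (Var 2) (Pair (Var 1) (Var 0)))))
         (Lam (comp_step j (Var 10) (Var 9) (Var 6) (Var 4) (Var 3))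
           (IndSig (App (App (Var 8) (Var 3)) (Var 5))
             (IndSig (App (App (Var 10) (Var 5)) (Var 7))
               (App (App (App (App (App (App (App (transport_rel i (max i j))
                 (Var 15)) (Var 11)) (Var 3)) (Var 6)) (Var 8))
                 (App (App (App (App (App (Var 13) (Var 9)) (Var 3)) (Var 6)) (Var 1)) (Var 5)))
                 (Var 0))
               (Var 0))
             (Var 0))))
         (App (App (Var 5) (Var 1)) (Var 3)))
       (Var 0)"

definition dec_step_nodom :: "nat \<Rightarrow> nat \<Rightarrow> tm" where
  "dec_step_nodom i j = Inr (App (App (trunc_neg (max i j))
     (comp_step j (Var 8) (Var 7) (Var 4) (Var 2) (Var 1)))
     (Lam (comp_step j (Var 8) (Var 7) (Var 4) (Var 2) (Var 1))
       (IndSig Empty (IndSig Empty (App (Var 5) (Pair (Var 3) (Var 1))) (Var 0)) (Var 0))))"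

text \<open>If \<open>x R y\<close>, the map from \<open>S y z\<close> pairs with \<open>y\<close>;
  the map back splits a chain through \<open>y'\<close>, obtains \<open>y' = y\<close> from
  \<open>s\<close>, and transports. Otherwise the first step of any chain contradicts the branch
  hypothesis.\<close>

definition dec_step :: "nat \<Rightarrow> nat \<Rightarrow> tm" where
  "dec_step i j = Lam (Univ i) (Lam (Rel j (Var 0))
     (Lam (single_valued_rel j (Var 1) (Var 0)) (Lam (decidable_domain j (Var 2) (Var 1))
     (Lam (Arr (Var 3) (Arr (Var 3) (Univ (max i j))))
     (Lam (Pi (Var 4) (Pi (Var 5) (Dec (Trunc (App (App (Var 2) (Var 1)) (Var 0))))))
     (Lam (Var 5) (Lam (Var 6)
       (IndSum (Dec (Trunc (comp_step j (Var 8) (Var 7) (Var 4) (Var 2) (Var 1))))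
         (dec_step_dom i j) (dec_step_nodom i j) (App (Var 4) (Var 1))))))))))"

lemma chk_dec_step [simp]:
  "chk (is_type 3) (dec_step i j) \<Gamma> None = Some
     (Pi (Univ i) (Pi (Rel j (Var 0))
     (Pi (single_valued_rel j (Var 1) (Var 0)) (Pi (decidable_domain j (Var 2) (Var 1))
     (Pi (Arr (Var 3) (Arr (Var 3) (Univ (max i j))))
     (Pi (Pi (Var 4) (Pi (Var 5) (Dec (Trunc (App (App (Var 2) (Var 1)) (Var 0))))))
     (Pi (Var 5) (Pi (Var 6)
       (Dec (Trunc (comp_step j (Var 7) (Var 6) (Var 3) (Var 1) (Var 0))))))))))))"
  by (simp add: dec_step_def dec_step_dom_def dec_step_nodom_def comp_step_def type_defs compute_defs)

subsection \<open>Recursion equations of the closure\<close>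

text \<open>Congruence of application followed by \<open>pi_beta\<close>. The substitution results
  are separate equations, so that the simplifier computes them together with the checks.\<close>

lemma app_beta_eq:
  assumes "ctx \<Gamma>" "\<Gamma> \<turnstile> f \<^bold>= Lam A b \<^bold>: Pi A B" "is_type 3 \<Gamma> A" "checks (A # \<Gamma>) b B" "checks \<Gamma> a A"
    and "subst (a \<cdot> Var) b = c" "subst (a \<cdot> Var) B = C"
  shows "\<Gamma> \<turnstile> App f a \<^bold>= c \<^bold>: C"
proof -
  have "\<Gamma> \<turnstile> a \<^bold>: A" "A # \<Gamma> \<turnstile> b \<^bold>: B"
    using assms(1,3-5) by (blast intro: chk_typed ctx_step)+
  then have "\<Gamma> \<turnstile> App f a \<^bold>= App (Lam A b) a \<^bold>: subst (a \<cdot> Var) B"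
    "\<Gamma> \<turnstile> App (Lam A b) a \<^bold>= subst (a \<cdot> Var) b \<^bold>: subst (a \<cdot> Var) B"
    using assms(2) by (auto intro: app_eq eq_refl pi_beta)
  then show ?thesis
    using assms(6,7) by (blast intro: eq_trans)
qed

lemma
  assumes "ctx \<Gamma>" "is_type 3 (NatT # \<Gamma>) C" "checks \<Gamma> c (subst (Zero \<cdot> Var) C)"
    and "checks (C # NatT # \<Gamma>) s (subst (Succ (Var 1) \<cdot> (\<lambda>n. Var (n + 2))) C)"
  shows rec_Zero_eq: "c = t \<Longrightarrow> subst (Zero \<cdot> Var) C = T \<Longrightarrow> \<Gamma> \<turnstile> IndNat C c s Zero \<^bold>= t \<^bold>: T"
    and rec_Succ_eq: "checks \<Gamma> n NatT \<Longrightarrow> subst (IndNat C c s n \<cdot> n \<cdot> Var) s = t \<Longrightarrow>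
      subst (Succ n \<cdot> Var) C = T \<Longrightarrow> \<Gamma> \<turnstile> IndNat C c s (Succ n) \<^bold>= t \<^bold>: T"
proof -
  have "ctx (NatT # \<Gamma>)"
    using assms(1) by (blast intro: ctx_cons nat_form)
  moreover from this obtain i where "NatT # \<Gamma> \<turnstile> C \<^bold>: Univ i"
    using assms(2) is_type_sound by blast
  moreover have "C # NatT # \<Gamma> \<turnstile> s \<^bold>: subst (Succ (Var 1) \<cdot> (\<lambda>n. Var (n + 2))) C"
    using calculation assms(4) by (blast intro: chk_typed ctx_cons)
  moreover have "\<Gamma> \<turnstile> c \<^bold>: subst (Zero \<cdot> Var) C"
    using assms(1,3) by (rule chk_typed)
  ultimately show "c = t \<Longrightarrow> subst (Zero \<cdot> Var) C = T \<Longrightarrow> \<Gamma> \<turnstile> IndNat C c s Zero \<^bold>= t \<^bold>: T"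
    "checks \<Gamma> n NatT \<Longrightarrow> subst (IndNat C c s n \<cdot> n \<cdot> Var) s = t \<Longrightarrow>
      subst (Succ n \<cdot> Var) C = T \<Longrightarrow> \<Gamma> \<turnstile> IndNat C c s (Succ n) \<^bold>= t \<^bold>: T"
    using assms(1) by (blast intro: nat_beta_zero nat_beta_succ chk_typed)+
qed

text \<open>Negation is a \<open>Pi\<close> over \<open>Trunc A\<close>, so its congruence rule
  needs \<open>Trunc A\<close> to extend the context; hence the typing of \<open>A\<close> is
  assumed beside the equality.\<close>

lemma dec_trunc_cong:
  assumes "\<Gamma> \<turnstile> A \<^bold>= A' \<^bold>: Univ i" "\<Gamma> \<turnstile> A \<^bold>: Univ i" "ctx \<Gamma>"
  shows "\<Gamma> \<turnstile> Dec (Trunc A) \<^bold>= Dec (Trunc A') \<^bold>: Univ i"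
proof -
  have "\<Gamma> \<turnstile> Trunc A \<^bold>= Trunc A' \<^bold>: Univ i" "\<Gamma> \<turnstile> Trunc A \<^bold>: Univ i"
    using assms by (auto intro: trunc_form_eq trunc_form)
  moreover from this assms(3) have "Trunc A # \<Gamma> \<turnstile> Empty \<^bold>= Empty \<^bold>: Univ i"
    by (intro eq_refl empty_form) (rule ctx_cons)
  ultimately show ?thesis
    by (auto simp: Dec_def Neg_def Arr_def intro: sum_form_eq pi_form_eq)
qed

text \<open>Here \<open>X\<close> is \<open>Var 4\<close> and \<open>R\<close> is
  \<open>Var 3\<close>; each entry added in front raises both indices by one.\<close>

definition hyps :: "nat \<Rightarrow> nat \<Rightarrow> tm list" where
  "hyps i j = [decidable_domain j (Var 3) (Var 2), single_valued_rel j (Var 2) (Var 1),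
     decidable_equality (Var 1), Rel j (Var 0), Univ i]"

text \<open>
  In \<open>succ_ctx\<close>, the outer \<open>NatT\<close> is the argument of the family of closures and the inner one
  the predecessor bound by the recursor, followed by the induction hypothesis, \<open>x\<close> and \<open>z\<close>.
\<close>

abbreviation zero_ctx :: "nat \<Rightarrow> nat \<Rightarrow> tm list" where
  "zero_ctx i j \<equiv> Var 6 # Var 5 # NatT # hyps i j"

text \<open>The motive of the induction, over \<open>NatT # NatT # hyps i j\<close>, with the number
  of steps as \<open>Var 0\<close>.\<close>

definition dec_all :: "nat \<Rightarrow> nat \<Rightarrow> tm" where
  "dec_all i j = Pi (Var 6) (Pi (Var 7)
     (Dec (step_closure i j (Var 8) (Var 7) (Var 2) (Var 1) (Var 0))))"

abbreviation succ_ctx :: "nat \<Rightarrow> nat \<Rightarrow> tm list" where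
  "succ_ctx i j \<equiv> Var 8 # Var 7 # dec_all i j # NatT # NatT # hyps i j"

lemmas all_defs = hyps_def dec_all_def step_closure_def step_rel_def decidable_equality_def
  comp_step_def type_defs compute_defs

lemma ctx_hyps: "ctx (hyps i j)"
  unfolding hyps_def by (intro ctx_step[where n = 3] ctx_nil) (simp_all add: all_defs)

lemma ctx_zero: "ctx (zero_ctx i j)"
  by (intro ctx_step[where n = 3] ctx_hyps) (simp_all add: all_defs)

lemma ctx_succ: "ctx (succ_ctx i j)"
  by (intro ctx_step[where n = 3] ctx_hyps) (simp_all add: all_defs)

lemma step_rel_Zero:
  "zero_ctx i j \<turnstile> App (App (step_rel i j (Var 7) (Var 6) Zero) (Var 1)) (Var 0)
     \<^bold>= Eq (Var 7) (Var 1) (Var 0) \<^bold>: Univ (max i j)"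
proof -
  have "zero_ctx i j \<turnstile> step_rel i j (Var 7) (Var 6) Zero
    \<^bold>= Lam (Var 7) (Lam (Var 8) (Eq (Var 9) (Var 1) (Var 0))) \<^bold>: Pi (Var 7) (Arr (Var 8) (Univ (max i j)))"
    unfolding step_rel_def by (rule rec_Zero_eq[OF ctx_zero]) (simp_all add: all_defs)
  \<comment> \<open>The recursor has computed; two beta steps now consume the arguments one at a
    time.\<close>
  then have "zero_ctx i j \<turnstile> App (step_rel i j (Var 7) (Var 6) Zero) (Var 1)
    \<^bold>= Lam (Var 7) (Eq (Var 8) (Var 2) (Var 0)) \<^bold>: Pi (Var 7) (Univ (max i j))"
    by (rule app_beta_eq[OF ctx_zero]) (simp_all add: all_defs)
  then show ?thesis
    by (rule app_beta_eq[OF ctx_zero]) (simp_all add: all_defs)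
qed

lemma step_rel_Succ:
  "succ_ctx i j \<turnstile> App (App (step_rel i j (Var 9) (Var 8) (Succ (Var 3))) (Var 1)) (Var 0)
     \<^bold>= comp_step j (Var 9) (Var 8) (step_rel i j (Var 9) (Var 8) (Var 3)) (Var 1) (Var 0) \<^bold>: Univ (max i j)"
proof -
  have "succ_ctx i j \<turnstile> step_rel i j (Var 9) (Var 8) (Succ (Var 3))
    \<^bold>= Lam (Var 9) (Lam (Var 10) (comp_step j (Var 11) (Var 10) (step_rel i j (Var 11) (Var 10) (Var 5)) (Var 1) (Var 0)))
       \<^bold>: Pi (Var 9) (Arr (Var 10) (Univ (max i j)))"
    unfolding step_rel_def by (rule rec_Succ_eq[OF ctx_succ]) (simp_all add: all_defs)
  then have "succ_ctx i j \<turnstile> App (step_rel i j (Var 9) (Var 8) (Succ (Var 3))) (Var 1)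
    \<^bold>= Lam (Var 9) (comp_step j (Var 10) (Var 9) (step_rel i j (Var 10) (Var 9) (Var 4)) (Var 2) (Var 0))
       \<^bold>: Pi (Var 9) (Univ (max i j))"
    by (rule app_beta_eq[OF ctx_succ]) (simp_all add: all_defs)
  then show ?thesis
    by (rule app_beta_eq[OF ctx_succ]) (simp_all add: all_defs)
qed

subsection \<open>Induction on the number of steps\<close>

text \<open>The only use of \<open>conv\<close>. The checker types \<open>t\<close> at the computed
  form \<open>B\<close>; the equality is reversed so that \<open>B\<close>, which is checked, is the
  side whose typing the congruence needs.\<close>

lemma dec_trunc_conv:
  assumes "ctx \<Gamma>" "\<Gamma> \<turnstile> A \<^bold>= B \<^bold>: Univ i" "checks \<Gamma> B (Univ i)" "checks \<Gamma> t (Dec (Trunc B))"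
  shows "\<Gamma> \<turnstile> t \<^bold>: Dec (Trunc A)"
  using chk_typed[OF assms(1,4)] dec_trunc_cong[OF eq_sym[OF assms(2)] chk_typed[OF assms(1,3)] assms(1)]
  by (rule conv)

definition zero_case :: "nat \<Rightarrow> nat \<Rightarrow> tm" where
  "zero_case i j = Lam (Var 5) (Lam (Var 6) (App (App (dec_trunc (max i j)) (Eq (Var 7) (Var 1) (Var 0)))
     (App (App (Var 5) (Var 1)) (Var 0))))"

text \<open>With \<open>S\<close> taken as \<open>step_rel\<close> at the predecessor
  \<open>Var 3\<close>, the hypothesis \<open>h\<close> of \<open>dec_step\<close> is syntactically
  the induction hypothesis \<open>Var 2\<close>.\<close>

definition succ_case :: "nat \<Rightarrow> nat \<Rightarrow> tm" where
  "succ_case i j = Lam (Var 7) (Lam (Var 8)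
     (App (App (App (App (App (App (App (App (dec_step i j) (Var 9)) (Var 8)) (Var 6)) (Var 5))
       (step_rel i j (Var 9) (Var 8) (Var 3))) (Var 2)) (Var 1)) (Var 0)))"

lemma zero_case_typed: "NatT # hyps i j \<turnstile> zero_case i j \<^bold>: subst (Zero \<cdot> Var) (dec_all i j)"
proof -
  have "zero_ctx i j \<turnstile> App (App (dec_trunc (max i j)) (Eq (Var 7) (Var 1) (Var 0)))
     (App (App (Var 5) (Var 1)) (Var 0)) \<^bold>: Dec (Trunc (App (App (step_rel i j (Var 7) (Var 6) Zero) (Var 1)) (Var 0)))"
    by (rule dec_trunc_conv[OF ctx_zero step_rel_Zero]) (simp_all add: all_defs)
  then have "NatT # hyps i j \<turnstile> zero_case i j \<^bold>:
     Pi (Var 5) (Pi (Var 6) (Dec (Trunc (App (App (step_rel i j (Var 7) (Var 6) Zero) (Var 1)) (Var 0)))))"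
    unfolding zero_case_def
    by (intro lam_checks ctx_step[where n = 3] ctx_hyps) (simp_all add: all_defs)
  moreover have "subst (Zero \<cdot> Var) (dec_all i j) =
     Pi (Var 5) (Pi (Var 6) (Dec (Trunc (App (App (step_rel i j (Var 7) (Var 6) Zero) (Var 1)) (Var 0)))))"
    by (simp add: all_defs)
  ultimately show ?thesis by metis
qed

lemma succ_case_typed: "dec_all i j # NatT # NatT # hyps i j \<turnstile> succ_case i j
  \<^bold>: subst (Succ (Var 1) \<cdot> (\<lambda>n. Var (n + 2))) (dec_all i j)"
proof -
  have "succ_ctx i j \<turnstile> App (App (App (App (App (App (App (App (dec_step i j) (Var 9)) (Var 8)) (Var 6)) (Var 5))
       (step_rel i j (Var 9) (Var 8) (Var 3))) (Var 2)) (Var 1)) (Var 0)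
    \<^bold>: Dec (Trunc (App (App (step_rel i j (Var 9) (Var 8) (Succ (Var 3))) (Var 1)) (Var 0)))"
    by (rule dec_trunc_conv[OF ctx_succ step_rel_Succ]) (simp_all add: all_defs)
  then have "dec_all i j # NatT # NatT # hyps i j \<turnstile> succ_case i j \<^bold>:
     Pi (Var 7) (Pi (Var 8) (Dec (Trunc (App (App (step_rel i j (Var 9) (Var 8) (Succ (Var 3))) (Var 1)) (Var 0)))))"
    unfolding succ_case_def
    by (intro lam_checks ctx_step[where n = 3] ctx_hyps) (simp_all add: all_defs)
  moreover have "subst (Succ (Var 1) \<cdot> (\<lambda>n. Var (n + 2))) (dec_all i j) =
     Pi (Var 7) (Pi (Var 8) (Dec (Trunc (App (App (step_rel i j (Var 9) (Var 8) (Succ (Var 3))) (Var 1)) (Var 0)))))"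
    by (simp add: all_defs)
  ultimately show ?thesis by metis
qed

lemma closures_typed:
  "hyps i j \<turnstile> Lam NatT (IndNat (dec_all i j) (zero_case i j) (succ_case i j) (Var 0))
     \<^bold>: decidable_closures i j (Var 4) (Var 3)"
proof -
  have ctx: "ctx (NatT # hyps i j)" "ctx (NatT # NatT # hyps i j)"
    by (blast intro: ctx_hyps ctx_cons nat_form)+
  have "is_type 3 (NatT # NatT # hyps i j) (dec_all i j)"
    by (simp add: all_defs)
  then obtain l where "NatT # NatT # hyps i j \<turnstile> dec_all i j \<^bold>: Univ l"
    using is_type_sound ctx(2) by blast
  moreover have "NatT # hyps i j \<turnstile> Var 0 \<^bold>: NatT"
    by (rule chk_typed[OF ctx(1), where n = 3 and E = None]) simp
  ultimately have "NatT # hyps i j \<turnstile> IndNat (dec_all i j) (zero_case i j) (succ_case i j) (Var 0)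
    \<^bold>: subst (Var 0 \<cdot> Var) (dec_all i j)"
    by (blast intro: ind_nat zero_case_typed succ_case_typed)
  then have "hyps i j \<turnstile> Lam NatT (IndNat (dec_all i j) (zero_case i j) (succ_case i j) (Var 0))
     \<^bold>: Pi NatT (subst (Var 0 \<cdot> Var) (dec_all i j))"
    by (blast intro: lam nat_form ctx_hyps)
  \<comment> \<open>The motive has its own number variable; substituting \<open>Var 0\<close>
    identifies it with the argument of the outer \<open>Lam\<close>.\<close>
  moreover have "Pi NatT (subst (Var 0 \<cdot> Var) (dec_all i j)) = decidable_closures i j (Var 4) (Var 3)"
    by (simp add: decidable_closures_def all_defs)
  ultimately show ?thesis by metis
qed

theorem theorem8p11:
  fixes i j :: nat
  shows "inhabited
    (Pi (Univ i)
    (Pi (Rel j (Var 0))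
      (Arr (decidable_equality (Var 1))
      (Arr (single_valued_rel j (Var 1) (Var 0))
      (Arr (decidable_domain j (Var 1) (Var 0))
        (decidable_closures i j (Var 1) (Var 0)))))))" (is "inhabited ?T")
proof -
  let ?t = "Lam (Univ i) (Lam (Rel j (Var 0)) (Lam (decidable_equality (Var 1))
    (Lam (single_valued_rel j (Var 2) (Var 1)) (Lam (decidable_domain j (Var 3) (Var 2))
      (Lam NatT (IndNat (dec_all i j) (zero_case i j) (succ_case i j) (Var 0)))))))"
  have "[] \<turnstile> ?t \<^bold>: Pi (Univ i) (Pi (Rel j (Var 0)) (Pi (decidable_equality (Var 1))
    (Pi (single_valued_rel j (Var 2) (Var 1)) (Pi (decidable_domain j (Var 3) (Var 2))
      (decidable_closures i j (Var 4) (Var 3))))))" (is "_ \<turnstile> _ \<^bold>: ?T'")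
    by (intro lam_checks ctx_step[where n = 3] ctx_nil closures_typed[unfolded hyps_def])
       (simp_all add: all_defs)
  \<comment> \<open>\<open>Arr\<close> weakens its codomain, which accounts for the index shifts
    between the two forms.\<close>
  moreover have "?T = ?T'"
    by (simp add: decidable_closures_def all_defs)
  ultimately show ?thesis
    unfolding inhabited_def by metis
qed

end
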